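(* For all integers $r > s \geq 1$ there exists a constant $n_0' = n_0'(r,s)$ such that for every $n \geq n_0'$, $t_{\max}(n,r,s) < n - r - 1$.
   Context: For an $r$-graph $G$ and $0 \le s \le r$, the higher inclusion matrix $M_s^r(G)$ is the $\{0,1\}$-matrix with rows indexed by the edges of $G$ and columns indexed by the $s$-subsets of $V(G)$, the entry for edge $e$ and $s$-set $S$ being $1$ if $S \subseteq e$ and $0$ otherwise; $\mathrm{rk}$ is rank over the reals; $|G|$ is the number of edges. For $0 \le t \le \binom{n}{s}$, $\mathrm{rex}(n,t,r,s) = \max\{|G| : G \text{ an } r\text{-graph on } [n],\ \mathrm{rk}\, M_s^r(G) \le \binom{n}{s} - t\}$. For a family $\mathcal{F}$ of $k$-subsets of $[n]$ and $p\ge 1$, its upper $p$-shadow $\partial_u^p\mathcal{F}$ is the set of all $(k+p)$-subsets of $[n]$ containing at least one member of $\mathcal{F}$, and $K(n,m,k,p) = \min\{|\partial_u^p \mathcal{F}| : \mathcal{F} \subseteq \binom{[n]}{k},\ |\mathcal{F}| = m\}$. Finally $t_{\max}(n,r,s) = \max\{1 \le t \le \binom{n}{s} : \binom{n}{r} - \mathrm{rex}(n,t',r,s) = K(n,t',s,r-s) \text{ for all } t' \le t\}$. *)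

theory Defs
  imports "Jordan_Normal_Form.DL_Rank" "HOL-Library.Ramsey" "HOL-Library.Countable_Set"
begin

(* An r-graph on the vertex set V is represented by its edge set G \<subseteq> nsets V r, where
   nsets V r is the set of all r-element subsets of V.  Throughout, [n] is {1..n}. *)

(* Rows (edges) and columns (s-subsets of V) are numbered by the library enumeration
   from_nat_into, which for a finite set A is a bijection from {..<card A} onto A; the rank
   does not depend on the numbering. *)
definition inclusion_matrix :: "nat \<Rightarrow> 'a set \<Rightarrow> 'a set set \<Rightarrow> real mat" where
  "inclusion_matrix s V G =
     mat (card G) (card (nsets V s))
       (\<lambda>(i, j). if from_nat_into (nsets V s) j \<subseteq> from_nat_into G i then 1 else 0)"

(* The explicit argument card G of rank is the number of rows, i.e. the dimension of the ambient
   space of the columns. *)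
definition inclusion_rank :: "nat \<Rightarrow> 'a set \<Rightarrow> 'a set set \<Rightarrow> nat" where
  "inclusion_rank s V G = vec_space.rank (card G) (inclusion_matrix s V G)"

(* Only meaningful for t \<le> n choose s, because of the truncated subtraction. *)
definition rex :: "nat \<Rightarrow> nat \<Rightarrow> nat \<Rightarrow> nat \<Rightarrow> nat" where
  "rex n t r s =
     Max {card G | G. G \<subseteq> nsets {1..n} r \<and> inclusion_rank s {1..n} G \<le> (n choose s) - t}"

definition upper_shadow :: "'a set \<Rightarrow> nat \<Rightarrow> nat \<Rightarrow> 'a set set \<Rightarrow> 'a set set" where
  "upper_shadow V k p F = {e \<in> nsets V (k + p). \<exists>S\<in>F. S \<subseteq> e}"

(* Only meaningful for m \<le> n choose k; otherwise the set below is empty. *)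
definition min_upper_shadow :: "nat \<Rightarrow> nat \<Rightarrow> nat \<Rightarrow> nat \<Rightarrow> nat" where
  "min_upper_shadow n m k p =
     Min {card (upper_shadow {1..n} k p F) | F. F \<subseteq> nsets {1..n} k \<and> card F = m}"

(* Max is unspecified on the empty set, so no bound on t_max can be derived without the existence
   of at least one admissible t. *)
definition t_max :: "nat \<Rightarrow> nat \<Rightarrow> nat \<Rightarrow> nat" where
  "t_max n r s =
     Max {t. 1 \<le> t \<and> t \<le> n choose s \<and>
            (\<forall>t'\<le>t. int (n choose r) - int (rex n t' r s) = int (min_upper_shadow n t' s (r - s)))}"

end

theory Submission
  imports Defs
begin

text \<open>Call \<open>f\<close>, a function on \<open>r\<close>-sets, of degree at most \<open>s\<close> if all its \<open>(s + 1)\<close>-fold differences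
  over disjoint pairs of vertices vanish; for a vector \<open>x\<close> of the column space this holds for
  \<open>f e = (\<Sum>S\<subseteq>e. x S)\<close>. For large \<open>n\<close> a nonzero such \<open>f\<close> is nonzero on at least
  \<open>(n - s) choose (r - s)\<close> edges. If all \<open>s\<close>-fold differences vanish after deletion of a vertex \<open>v\<close>,
  either \<open>f\<close> is nonzero on the deletion and has lower degree there, so its support has larger order of
  magnitude, or the link of \<open>v\<close> has degree at most \<open>s - 1\<close> and induction applies. Otherwise
  nonvanishing differences avoiding every given vertex exist, and a bounded set \<open>Q\<close> of vertices can
  be chosen such that every \<open>(r - s)\<close>-set outside \<open>Q\<close> extends in at least two ways to an edge in the
  support. This makes \<open>t = 1\<close> admissible, so that the maximum defining \<open>t_max\<close> is attained.

  The value \<open>t = n - r - 1\<close> is not admissible: the minimal shadow misses only \<open>r - s + 2\<close> of the edges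
  through a fixed \<open>(s - 1)\<close>-set, whereas \<open>2 ^ (r - s + 1)\<close> of these edges can be kept within the rank
  bound.\<close>

subsection \<open>Functions of bounded degree on uniform set systems\<close>

lemma nsets_iff_finite: "finite V \<Longrightarrow> e \<in> nsets V k \<longleftrightarrow> e \<subseteq> V \<and> card e = k"
  by (auto simp: nsets_def intro: finite_subset)

lemma card_nsets:
  assumes "finite V"
  shows "card (nsets V k) = card V choose k"
proof -
  have "nsets V k = {e. e \<subseteq> V \<and> card e = k}"
    using assms by (auto simp: nsets_iff_finite)
  then show ?thesis using n_subsets[OF assms] by simp
qed

text \<open>An edge \<open>e\<close> determines \<open>U\<close> as \<open>e - Q\<close>, so the
  families for different \<open>U\<close> are disjoint. This counts a support by the parts of its
  edges outside a bounded vertex set \<open>Q\<close>.\<close>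

lemma card_fibres_le:
  assumes "finite V" "Q \<subseteq> V" "finite N"
    and ex: "\<And>U. U \<in> nsets (V - Q) k \<Longrightarrow> \<exists>E\<subseteq>N. card E = m \<and> (\<forall>e\<in>E. e - Q = U)"
  shows "m * ((card V - card Q) choose k) \<le> card N"
proof -
  obtain E where E: "\<And>U. U \<in> nsets (V - Q) k \<Longrightarrow> E U \<subseteq> N \<and> card (E U) = m \<and> (\<forall>e\<in>E U. e - Q = U)"
    using ex by metis
  have fin: "finite (nsets (V - Q) k)" using assms by (simp add: finite_imp_finite_nsets)
  have "card (\<Union>U\<in>nsets (V - Q) k. E U) = (\<Sum>U\<in>nsets (V - Q) k. card (E U))"
  proof (rule card_UN_disjoint[OF fin])
    show "\<forall>U\<in>nsets (V - Q) k. finite (E U)" using E assms(3) finite_subset by metis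
    show "\<forall>U\<in>nsets (V - Q) k. \<forall>U'\<in>nsets (V - Q) k. U \<noteq> U' \<longrightarrow> E U \<inter> E U' = {}"
      using E by (metis disjoint_iff)
  qed
  also have "\<dots> = m * ((card V - card Q) choose k)"
    using E assms by (simp add: card_nsets card_Diff_subset finite_subset)
  finally have "card (\<Union>U\<in>nsets (V - Q) k. E U) = m * ((card V - card Q) choose k)" .
  moreover have "(\<Union>U\<in>nsets (V - Q) k. E U) \<subseteq> N" using E by blast
  ultimately show ?thesis using card_mono[OF assms(3)] by metis
qed

section \<open>Iterated differences over disjoint pairs of vertices\<close>

fun verts :: "('a \<times> 'a) list \<Rightarrow> 'a set" where
  "verts [] = {}"
| "verts ((a, b) # ps) = insert a (insert b (verts ps))"

fun disjoint_pairs :: "('a \<times> 'a) list \<Rightarrow> bool" where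
  "disjoint_pairs [] = True"
| "disjoint_pairs ((a, b) # ps) = (a \<noteq> b \<and> a \<notin> verts ps \<and> b \<notin> verts ps \<and> disjoint_pairs ps)"

fun swap_diff :: "('a \<times> 'a) list \<Rightarrow> ('a set \<Rightarrow> real) \<Rightarrow> 'a set \<Rightarrow> real" where
  "swap_diff [] f U = f U"
| "swap_diff ((a, b) # ps) f U = swap_diff ps f (insert a U) - swap_diff ps f (insert b U)"

text \<open>Demanding \<open>k + d = r\<close> rather than setting \<open>k = r - d\<close> makes
  the condition vacuous for \<open>d > r\<close>.\<close>

definition deg_less :: "'a set \<Rightarrow> nat \<Rightarrow> nat \<Rightarrow> ('a set \<Rightarrow> real) \<Rightarrow> bool" where
  "deg_less V r d f \<longleftrightarrow>
     (\<forall>ps U k. length ps = d \<longrightarrow> disjoint_pairs ps \<longrightarrow> verts ps \<subseteq> V \<longrightarrow>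
        U \<in> nsets (V - verts ps) k \<longrightarrow> k + d = r \<longrightarrow> swap_diff ps f U = 0)"

lemma deg_lessD:
  "deg_less V r d f \<Longrightarrow> length ps = d \<Longrightarrow> disjoint_pairs ps \<Longrightarrow> verts ps \<subseteq> V \<Longrightarrow>
    U \<in> nsets (V - verts ps) k \<Longrightarrow> k + d = r \<Longrightarrow> swap_diff ps f U = 0"
  unfolding deg_less_def by blast

lemma finite_verts [simp]: "finite (verts ps)"
  by (induction ps rule: verts.induct) auto

lemma card_verts: "disjoint_pairs ps \<Longrightarrow> card (verts ps) = 2 * length ps"
  by (induction ps rule: verts.induct) auto

lemma swap_diff_nonzeroE:
  assumes "swap_diff ps f U \<noteq> 0" "disjoint_pairs ps"
  obtains c where "c \<in> nsets (verts ps) (length ps)" "f (c \<union> U) \<noteq> 0"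
proof -
  have "\<exists>c \<in> nsets (verts ps) (length ps). f (c \<union> U) \<noteq> 0"
    using assms
  proof (induction ps arbitrary: U rule: verts.induct)
    case 1
    then show ?case by (auto simp: nsets_def)
  next
    case (2 a b ps)
    have "swap_diff ps f (insert a U) \<noteq> 0 \<or> swap_diff ps f (insert b U) \<noteq> 0"
      using 2(2) by auto
    then obtain x where x: "x = a \<or> x = b" "swap_diff ps f (insert x U) \<noteq> 0" by metis
    then obtain c where c: "c \<in> nsets (verts ps) (length ps)" "f (c \<union> insert x U) \<noteq> 0"
      using "2.IH"[OF x(2)] 2(3) by auto
    have "x \<notin> c" using c(1) x(1) 2(3) by (auto simp: nsets_def)
    then have "insert x c \<in> nsets (verts ((a, b) # ps)) (length ((a, b) # ps))"
      using c(1) x(1) by (auto simp: nsets_def)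
    then show ?case using c(2) by (metis Un_insert_left Un_insert_right)
  qed
  then show thesis using that by blast
qed

text \<open>The difference over one more pair \<open>(u, w)\<close> vanishes, so exchanging
  \<open>u\<close> for \<open>w\<close> in \<open>U\<close> changes nothing. Such exchanges lead
  from \<open>U\<close> to \<open>U'\<close>.\<close>

lemma swap_diff_const:
  assumes deg: "deg_less V r (Suc d) f" and ps: "length ps = d" "disjoint_pairs ps" "verts ps \<subseteq> V"
    and k: "k + d = r" and U: "U \<in> nsets (V - verts ps) k" "U' \<in> nsets (V - verts ps) k"
  shows "swap_diff ps f U = swap_diff ps f U'"
  using U
proof (induction "card (U - U')" arbitrary: U rule: less_induct)
  case less
  have fin: "finite U" "finite U'" and cd: "card U = k" "card U' = k"
    and sub: "U \<subseteq> V - verts ps" "U' \<subseteq> V - verts ps"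
    using less.prems by (auto simp: nsets_def)
  show ?case
  proof (cases "U \<subseteq> U'")
    case True
    then show ?thesis using fin cd card_subset_eq by metis
  next
    case False
    then obtain u where u: "u \<in> U" "u \<notin> U'" by blast
    have "\<not> U' \<subseteq> U" using False fin cd card_subset_eq by (metis order_refl)
    then obtain w where w: "w \<in> U'" "w \<notin> U" by blast
    let ?W = "U - {u}"
    have cW: "Suc (card ?W) = k" using u fin cd by (metis card_Suc_Diff1)
    have U2: "insert w ?W \<in> nsets (V - verts ps) k"
      using sub w fin cW by (auto simp: nsets_def)
    have "swap_diff ((u, w) # ps) f ?W = 0"
      by (rule deg_lessD[OF deg, where k = "k - 1"])
        (use ps u w sub fin cW k cd in \<open>auto simp: nsets_def\<close>)
    then have "swap_diff ps f U = swap_diff ps f (insert w ?W)"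
      using u(1) by (simp add: insert_absorb)
    also have "\<dots> = swap_diff ps f U'"
    proof (rule less.hyps[OF _ U2 less.prems(2)])
      have "insert w ?W - U' = (U - U') - {u}" using w by auto
      then show "card (insert w ?W - U') < card (U - U')"
        using u fin by (metis DiffI card_Diff1_less finite_Diff)
    qed
    finally show ?thesis .
  qed
qed

text \<open>Here \<open>d\<close> is the exact degree: some \<open>d\<close>-fold difference is
  nonzero while those of order \<open>d + 1\<close> vanish. By \<open>swap_diff_const\<close> it is
  then nonzero for every \<open>U\<close>.\<close>

lemma nondegenerate_pairsE:
  assumes deg: "deg_less V r (Suc s) f" and e: "e \<in> nsets V r" "f e \<noteq> 0"
  obtains d ps where "d \<le> s" "d \<le> r" "length ps = d" "disjoint_pairs ps" "verts ps \<subseteq> V"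
    "deg_less V r (Suc d) f"
    "\<And>U. U \<in> nsets (V - verts ps) (r - d) \<Longrightarrow> swap_diff ps f U \<noteq> 0"
    "nsets (V - verts ps) (r - d) \<noteq> {}"
proof -
  have "\<not> deg_less V r 0 f"
    using e unfolding deg_less_def by (auto intro!: exI[of _ "[]"])
  then obtain d where d: "d \<le> s" "\<not> deg_less V r d f" "deg_less V r (Suc d) f"
    using ex_least_nat_less[of "\<lambda>d. deg_less V r d f" "Suc s"] deg
    by (metis less_Suc_eq_le order_refl)
  then obtain ps U0 k where ps: "length ps = d" "disjoint_pairs ps" "verts ps \<subseteq> V"
    and U0: "U0 \<in> nsets (V - verts ps) k" "k + d = r" "swap_diff ps f U0 \<noteq> 0"
    unfolding deg_less_def by blast
  have k: "k = r - d" "d \<le> r" using U0 by auto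
  show thesis
  proof
    show "swap_diff ps f U \<noteq> 0" if "U \<in> nsets (V - verts ps) (r - d)" for U
      using swap_diff_const[OF d(3) ps U0(2), of U U0] U0 that k by auto
    show "nsets (V - verts ps) (r - d) \<noteq> {}" using U0 k by auto
  qed (use d ps k in auto)
qed

lemma nsets_Un_Diff:
  assumes "c \<in> nsets Q d" "U \<in> nsets (V - Q) (r - d)" "Q \<subseteq> V" "d \<le> r"
  shows "c \<union> U \<in> nsets V r" "(c \<union> U) - Q = U"
proof -
  have "c \<inter> U = {}" using assms by (auto simp: nsets_def)
  then show "c \<union> U \<in> nsets V r" "(c \<union> U) - Q = U"
    using assms by (auto simp: nsets_def card_Un_disjoint)
qed

text \<open>With \<open>d\<close> the exact degree, every \<open>(r - d)\<close>-set outside the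
  \<open>2 * d\<close> paired vertices extends to an edge of the support.\<close>

lemma support_ge_of_low_degree:
  assumes fin: "finite V" and deg: "deg_less V r (Suc s) f" and e: "e \<in> nsets V r" "f e \<noteq> 0"
  obtains d where "d \<le> s" "d \<le> r"
    "(card V - 2 * d) choose (r - d) \<le> card {e \<in> nsets V r. f e \<noteq> 0}"
proof -
  obtain d ps where d: "d \<le> s" "d \<le> r" and ps: "length ps = d" "disjoint_pairs ps" "verts ps \<subseteq> V"
    and nz: "\<And>U. U \<in> nsets (V - verts ps) (r - d) \<Longrightarrow> swap_diff ps f U \<noteq> 0"
    using nondegenerate_pairsE[OF deg e] by metis
  have "1 * ((card V - card (verts ps)) choose (r - d)) \<le> card {e \<in> nsets V r. f e \<noteq> 0}"
  proof (rule card_fibres_le[OF fin ps(3)])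
    show "finite {e \<in> nsets V r. f e \<noteq> 0}" using fin by (simp add: finite_imp_finite_nsets)
    fix U assume U: "U \<in> nsets (V - verts ps) (r - d)"
    obtain c where c: "c \<in> nsets (verts ps) d" "f (c \<union> U) \<noteq> 0"
      using swap_diff_nonzeroE[OF nz[OF U] ps(2)] ps(1) by blast
    show "\<exists>E\<subseteq>{e \<in> nsets V r. f e \<noteq> 0}. card E = 1 \<and> (\<forall>e\<in>E. e - verts ps = U)"
      using nsets_Un_Diff[OF c(1) U ps(3) d(2)] c(2) by (intro exI[of _ "{c \<union> U}"]) auto
  qed
  then show thesis using that d card_verts[OF ps(2)] ps(1) by auto
qed

lemma swap_diff_link: "swap_diff ps (\<lambda>U. f (insert v U)) U = swap_diff ps f (insert v U)"
  by (induction ps arbitrary: U rule: verts.induct) (auto simp: insert_commute)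

text \<open>For a fresh vertex \<open>w\<close>, the difference over \<open>(v, w)\<close> and
  \<open>ps\<close> vanishes. Its part with \<open>w\<close> involves only edges avoiding
  \<open>v\<close>, where \<open>f\<close> is zero, so the part with \<open>v\<close>, a difference
  of the link, vanishes too.\<close>

lemma deg_less_link:
  assumes fin: "finite V" and v: "v \<in> V" and deg: "deg_less V (Suc r) (Suc s) f"
    and zero: "\<And>e. e \<in> nsets (V - {v}) (Suc r) \<Longrightarrow> f e = 0" and big: "card V > r + s + 1"
  shows "deg_less (V - {v}) r s (\<lambda>U. f (insert v U))"
  unfolding deg_less_def swap_diff_link
proof (intro allI impI)
  fix ps U k
  assume ps: "length ps = s" "disjoint_pairs ps" "verts ps \<subseteq> V - {v}"
    and U: "U \<in> nsets (V - {v} - verts ps) k" and k: "k + s = r"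
  have U': "finite U" "card U = k" "U \<subseteq> V - {v} - verts ps" using U by (auto simp: nsets_def)
  \<comment> \<open>The vertex \<open>v\<close>, the \<open>2 * s\<close> paired vertices and the
    \<open>r - s\<close> vertices of \<open>U\<close> number at most \<open>r + s + 1\<close>, which
    leaves room for \<open>w\<close>.\<close>
  have "card (insert v (verts ps \<union> U)) \<le> Suc (2 * s + k)"
    using card_verts[OF ps(2)] ps(1) U' card_Un_le[of "verts ps" U]
    by (simp add: card_insert_if)
  then have "card (insert v (verts ps \<union> U)) < card V" using big k by simp
  then obtain w where w: "w \<in> V" "w \<notin> insert v (verts ps \<union> U)"
    using U'(1) by (metis card_mono finite_Un finite_insert finite_verts linorder_not_less subsetI)
  have "swap_diff ((v, w) # ps) f U = 0"
    by (rule deg_lessD[OF deg, where k = k]) (use ps U' w v k in \<open>auto simp: nsets_def\<close>)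
  moreover have "swap_diff ps f (insert w U) = 0"
  proof (rule ccontr)
    assume "swap_diff ps f (insert w U) \<noteq> 0"
    then obtain c where c: "c \<in> nsets (verts ps) s" "f (c \<union> insert w U) \<noteq> 0"
      using swap_diff_nonzeroE ps by blast
    have "insert w U \<in> nsets (V - {v} - verts ps) (Suc r - s)"
      using U' w k by (auto simp: nsets_def)
    then have "c \<union> insert w U \<in> nsets (V - {v}) (Suc r)"
      by (intro nsets_Un_Diff(1)[OF c(1) _ ps(3)]) (use k in auto)
    then show False using zero c(2) by blast
  qed
  ultimately show "swap_diff ps f (insert v U) = 0" by simp
qed

section \<open>Comparison of binomial coefficients\<close>

lemma binomial_le_double:
  assumes "2 * K * k \<le> n"
  shows "n choose k \<le> 2 * ((n - K) choose k)"
proof -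
  \<comment> \<open>By Pascal's rule, deleting \<open>K\<close> points loses at most a fraction
    \<open>K * k / n\<close> of \<open>n choose k\<close>, hence at most half.\<close>
  have step: "n choose k \<le> ((n - K) choose k) + K * ((n - 1) choose (k - 1))" if "0 < k" "K \<le> n" for K
    using that(2)
  proof (induction K)
    case (Suc K)
    have "(n - K) choose k = ((n - Suc K) choose k) + ((n - Suc K) choose (k - 1))"
      using choose_reduce_nat[of "n - K" k] that(1) Suc.prems by (simp add: Suc_diff_Suc)
    moreover have "(n - Suc K) choose (k - 1) \<le> (n - 1) choose (k - 1)"
      by (rule binomial_right_mono) simp
    ultimately show ?case using Suc by simp
  qed simp
  consider "k = 0" | "K = 0" | "0 < k" "0 < K" by auto
  then show ?thesis
  proof cases
    case 3
    have "K * 1 \<le> (2 * K) * k" using 3 by (intro mult_le_mono) auto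
    then have Kn: "K \<le> n" using assms by linarith
    have n: "0 < n" using 3 Kn by simp
    have "n * (2 * K * ((n - 1) choose (k - 1))) = 2 * K * k * (n choose k)"
      using times_binomial_minus1_eq[OF 3(1), of n] by (simp add: mult.assoc mult.left_commute)
    also have "\<dots> \<le> n * (n choose k)" using assms by simp
    finally have "2 * K * ((n - 1) choose (k - 1)) \<le> n choose k" using n by simp
    then show ?thesis using step[OF 3(1) Kn] by simp
  qed auto
qed

text \<open>Consecutive coefficients have ratio \<open>(m - j) / (j + 1)\<close>, which is at least
  two while \<open>3 * (j + 1) \<le> m\<close>.\<close>

lemma binomial_double_le:
  assumes "3 * k' \<le> m" "k < k'"
  shows "2 * (m choose k) \<le> m choose k'"
  using assms(2,1)
proof (induction k')
  case (Suc j)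
  have "Suc j * (2 * (m choose j)) \<le> (m - j) * (m choose j)"
    using Suc.prems(2) by (simp only: mult.assoc[symmetric]) (rule mult_le_mono1, simp)
  also have "\<dots> = Suc j * (m choose Suc j)"
    by (metis binomial_absorb_comp binomial_absorption)
  finally have step: "2 * (m choose j) \<le> m choose Suc j" by (simp del: mult_Suc)
  show ?case
  proof (cases "k = j")
    case False
    then show ?thesis using Suc step by simp
  qed (use step in simp)
qed simp

text \<open>The bound is exact: the indicator function of the edges through a fixed
  \<open>s\<close>-set attains it. In the induction \<open>r\<close> falls together with
  \<open>s\<close>, since the link of a vertex lives on smaller sets.\<close>

lemma support_ge:
  assumes "s \<le> r"
  shows "\<exists>n0. \<forall>V (f :: 'a set \<Rightarrow> real). finite V \<longrightarrow> n0 \<le> card V \<longrightarrow> deg_less V r (Suc s) f \<longrightarrow>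
    (\<exists>e\<in>nsets V r. f e \<noteq> 0) \<longrightarrow> (card V - s) choose (r - s) \<le> card {e \<in> nsets V r. f e \<noteq> 0}"
  using assms
proof (induction s arbitrary: r)
  case 0
  show ?case
  proof (intro exI[of _ 0] allI impI)
    fix V :: "'a set" and f :: "'a set \<Rightarrow> real"
    assume *: "finite V" "deg_less V r (Suc 0) f" "\<exists>e\<in>nsets V r. f e \<noteq> 0"
    then obtain e where "e \<in> nsets V r" "f e \<noteq> 0" by blast
    from support_ge_of_low_degree[OF *(1,2) this]
    show "(card V - 0) choose (r - 0) \<le> card {e \<in> nsets V r. f e \<noteq> 0}" by fastforce
  qed
next
  case (Suc s)
  then obtain r' where r: "r = Suc r'" "s \<le> r'" by (cases r) auto
  obtain n1 where n1: "\<And>V (f :: 'a set \<Rightarrow> real). finite V \<Longrightarrow> n1 \<le> card V \<Longrightarrow> deg_less V r' (Suc s) f \<Longrightarrow>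
    (\<exists>e\<in>nsets V r'. f e \<noteq> 0) \<Longrightarrow> (card V - s) choose (r' - s) \<le> card {e \<in> nsets V r'. f e \<noteq> 0}"
    using Suc.IH[OF r(2)] by blast
  \<comment> \<open>Bounds the size of \<open>Q\<close> below: one list of \<open>Suc s\<close>
    pairs, and a further list for each of its vertices.\<close>
  define K where "K = 2 * Suc s + 2 * Suc s * (2 * Suc s)"
  define n0 where "n0 = n1 + 2 * K * r + K + 3 * r + 2 * s + 3"
  show ?case
  proof (intro exI[of _ n0] allI impI)
    fix V :: "'a set" and f :: "'a set \<Rightarrow> real"
    assume fin: "finite V" and big: "n0 \<le> card V" and deg: "deg_less V r (Suc (Suc s)) f"
      and ex: "\<exists>e\<in>nsets V r. f e \<noteq> 0"
    let ?N = "{e \<in> nsets V r. f e \<noteq> 0}"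
    let ?n = "card V"
    have finN: "finite ?N" using fin by (simp add: finite_imp_finite_nsets)
    have ub: "(?n - Suc s) choose (r - Suc s) \<le> ?n choose (r - Suc s)"
      by (rule binomial_right_mono) simp
    have dbl: "?n choose (r - Suc s) \<le> 2 * ((?n - K') choose (r - Suc s))" if "K' \<le> K" for K'
    proof (rule binomial_le_double)
      have "2 * K' * (r - Suc s) \<le> 2 * K * r" using that by (intro mult_le_mono) auto
      then show "2 * K' * (r - Suc s) \<le> ?n" using big unfolding n0_def by linarith
    qed
    consider (drop) v where "v \<in> V" "deg_less (V - {v}) r (Suc s) f"
      | (full) "\<forall>v\<in>V. \<not> deg_less (V - {v}) r (Suc s) f" by blast
    then show "(?n - Suc s) choose (r - Suc s) \<le> card ?N"
    proof cases
      case (drop v)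
      have cv: "card (V - {v}) = ?n - 1" using drop fin by simp
      show ?thesis
      proof (cases "\<exists>e\<in>nsets (V - {v}) r. f e \<noteq> 0")
        case True
        then obtain d where d: "d \<le> s" "d \<le> r"
          "(card (V - {v}) - 2 * d) choose (r - d) \<le> card {e \<in> nsets (V - {v}) r. f e \<noteq> 0}"
          using support_ge_of_low_degree[OF _ drop(2)] fin by blast
        have K': "Suc (2 * d) \<le> K" using d unfolding K_def by simp
        \<comment> \<open>As \<open>d \<le> s\<close>, the lower index \<open>r - d\<close> exceeds
          \<open>r - Suc s\<close>, and this absorbs the factor two.\<close>
        have "?n choose (r - Suc s) \<le> 2 * ((?n - Suc (2 * d)) choose (r - Suc s))" by (rule dbl[OF K'])
        also have "\<dots> \<le> (?n - Suc (2 * d)) choose (r - d)"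
          by (rule binomial_double_le) (use big d Suc.prems in \<open>auto simp: n0_def\<close>)
        also have "\<dots> \<le> card {e \<in> nsets (V - {v}) r. f e \<noteq> 0}" using d(3) cv by simp
        also have "\<dots> \<le> card ?N"
          by (rule card_mono[OF finN]) (use nsets_mono[of "V - {v}" V r] in blast)
        finally show ?thesis using ub by simp
      next
        case False
        \<comment> \<open>Every edge of the support contains \<open>v\<close>, so passing to the
          link loses nothing. The vertex count, \<open>r\<close> and the degree all drop by one, and
          the bound keeps its form.\<close>
        let ?f = "\<lambda>U. f (insert v U)"
        have dl: "deg_less (V - {v}) r' (Suc s) ?f"
          by (rule deg_less_link[OF fin drop(1)]) (use deg False big r in \<open>auto simp: n0_def\<close>)
        obtain e where e: "e \<in> nsets V r" "f e \<noteq> 0" using ex by blast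
        then have "v \<in> e" using False by (auto simp: nsets_def)
        then have "e - {v} \<in> nsets (V - {v}) r'" "?f (e - {v}) \<noteq> 0"
          using e r by (auto simp: nsets_def insert_absorb)
        then have ex': "\<exists>e\<in>nsets (V - {v}) r'. ?f e \<noteq> 0" by blast
        have "n1 \<le> card (V - {v})" using big cv unfolding n0_def by simp
        from n1[OF _ this dl ex'] have
          "(?n - 1 - s) choose (r' - s) \<le> card {e \<in> nsets (V - {v}) r'. ?f e \<noteq> 0}"
          using fin cv by simp
        also have "\<dots> \<le> card ?N"
        proof (rule card_inj_on_le[of "insert v", OF _ _ finN])
          show "inj_on (insert v) {e \<in> nsets (V - {v}) r'. ?f e \<noteq> 0}"
            by (rule inj_onI) (auto simp: nsets_def)
          show "insert v ` {e \<in> nsets (V - {v}) r'. ?f e \<noteq> 0} \<subseteq> ?N"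
            using drop(1) r by (auto simp: nsets_def card_insert_disjoint subset_Diff_insert)
        qed
        finally show ?thesis using r by simp
      qed
    next
      case full
      \<comment> \<open>The nonzero difference found in \<open>V - {v}\<close> is constant as a
        difference in \<open>V\<close>, hence nonzero also for sets \<open>U\<close> containing
        \<open>v\<close>.\<close>
      have "\<exists>ps. length ps = Suc s \<and> disjoint_pairs ps \<and> verts ps \<subseteq> V - {v} \<and>
        (\<forall>U \<in> nsets (V - verts ps) (r - Suc s). swap_diff ps f U \<noteq> 0)" if v: "v \<in> V" for v
      proof -
        obtain ps U k where ps: "length ps = Suc s" "disjoint_pairs ps" "verts ps \<subseteq> V - {v}"
          and U: "U \<in> nsets (V - {v} - verts ps) k" "k + Suc s = r" "swap_diff ps f U \<noteq> 0"
          using bspec[OF full v] unfolding deg_less_def by blast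
        have k: "k = r - Suc s" using U by simp
        have psV: "verts ps \<subseteq> V" using ps(3) by blast
        have "U \<in> nsets (V - verts ps) k" using U(1) by (auto simp: nsets_def)
        then have "swap_diff ps f U' \<noteq> 0" if "U' \<in> nsets (V - verts ps) (r - Suc s)" for U'
          using swap_diff_const[OF deg ps(1,2) psV U(2), of U' U] U(3) that k by auto
        then show ?thesis using ps by blast
      qed
      then obtain P where P: "\<And>v. v \<in> V \<Longrightarrow> length (P v) = Suc s" "\<And>v. v \<in> V \<Longrightarrow> disjoint_pairs (P v)"
        "\<And>v. v \<in> V \<Longrightarrow> verts (P v) \<subseteq> V - {v}"
        "\<And>v U. v \<in> V \<Longrightarrow> U \<in> nsets (V - verts (P v)) (r - Suc s) \<Longrightarrow> swap_diff (P v) f U \<noteq> 0"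
        by metis
      have cP: "card (verts (P v)) = 2 * Suc s" if "v \<in> V" for v
        using card_verts P that by metis
      have "0 < ?n" using big unfolding n0_def by simp
      then obtain v0 where v0: "v0 \<in> V" using fin by fastforce
      \<comment> \<open>The second list is taken at a vertex of the first that depends on
        \<open>U\<close>, so \<open>Q\<close> includes all candidates.\<close>
      define Q where "Q = verts (P v0) \<union> (\<Union>v\<in>verts (P v0). verts (P v))"
      have QV: "Q \<subseteq> V" using P(3) v0 unfolding Q_def by blast
      have cQ: "card Q \<le> K"
      proof -
        have "card Q \<le> card (verts (P v0)) + card (\<Union>v\<in>verts (P v0). verts (P v))"
          unfolding Q_def by (rule card_Un_le)
        moreover have "card (\<Union>v\<in>verts (P v0). verts (P v)) \<le> card (verts (P v0)) * (2 * Suc s)"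
          using card_UN_le[of "verts (P v0)" "\<lambda>v. verts (P v)"] cP P(3)[OF v0]
            sum_bounded_above[of "verts (P v0)" "\<lambda>v. card (verts (P v))" "2 * Suc s"]
          by fastforce
        ultimately show ?thesis using cP[OF v0] unfolding K_def by simp
      qed
      have pick: "\<exists>c \<in> nsets (verts (P v)) (Suc s). c \<in> nsets Q (Suc s) \<and> f (c \<union> U) \<noteq> 0"
        if "v \<in> V" "verts (P v) \<subseteq> Q" "U \<in> nsets (V - Q) (r - Suc s)" for v U
      proof -
        have "U \<in> nsets (V - verts (P v)) (r - Suc s)" using that by (auto simp: nsets_def)
        from swap_diff_nonzeroE[OF P(4)[OF that(1) this] P(2)[OF that(1)]] P(1)[OF that(1)]
        obtain c where c: "c \<in> nsets (verts (P v)) (Suc s)" "f (c \<union> U) \<noteq> 0" by metis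
        moreover have "c \<in> nsets Q (Suc s)" using c(1) that(2) by (auto simp: nsets_def)
        ultimately show ?thesis by blast
      qed
      have "2 * ((?n - card Q) choose (r - Suc s)) \<le> card ?N"
      proof (rule card_fibres_le[OF fin QV finN])
        fix U assume U: "U \<in> nsets (V - Q) (r - Suc s)"
        obtain c where c: "c \<in> nsets (verts (P v0)) (Suc s)" "c \<in> nsets Q (Suc s)" "f (c \<union> U) \<noteq> 0"
          using pick[OF v0 _ U] unfolding Q_def by blast
        \<comment> \<open>A vertex \<open>v\<close> of \<open>c\<close> exists because
          \<open>Suc s > 0\<close>. The list \<open>P v\<close> avoids \<open>v\<close>, so the
          extension \<open>c'\<close> misses \<open>v\<close> and gives a different edge.\<close>
        have "c \<noteq> {}" using c by (auto simp: nsets_def)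
        then obtain v where v: "v \<in> c" "v \<in> verts (P v0)" using c(1) by (auto simp: nsets_def)
        then have vV: "v \<in> V" using P(3)[OF v0] by blast
        obtain c' where c': "c' \<in> nsets (verts (P v)) (Suc s)" "c' \<in> nsets Q (Suc s)" "f (c' \<union> U) \<noteq> 0"
          using pick[OF vV _ U] v(2) unfolding Q_def by blast
        have vU: "v \<notin> U" using U c v by (auto simp: nsets_def)
        have "v \<notin> c'" using c'(1) P(3)[OF vV] by (auto simp: nsets_def)
        then have ne: "c \<union> U \<noteq> c' \<union> U" using v(1) vU by blast
        have "c \<union> U \<in> ?N" "c' \<union> U \<in> ?N" "(c \<union> U) - Q = U" "(c' \<union> U) - Q = U"
          using nsets_Un_Diff[OF c(2) U QV Suc.prems] nsets_Un_Diff[OF c'(2) U QV Suc.prems] c(3) c'(3)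
          by blast+
        then show "\<exists>E\<subseteq>?N. card E = 2 \<and> (\<forall>e\<in>E. e - Q = U)"
          using ne by (intro exI[of _ "{c \<union> U, c' \<union> U}"]) auto
      qed
      \<comment> \<open>Two edges for each \<open>U\<close> make up for the discarded vertices of
        \<open>Q\<close>.\<close>
      then show ?thesis using dbl[OF cQ] ub by simp
    qed
  qed
qed

section \<open>Linear combinations of the columns as functions on edges\<close>

definition lift :: "nat \<Rightarrow> ('a set \<Rightarrow> real) \<Rightarrow> 'a set \<Rightarrow> real" where
  "lift m x e = (\<Sum>S\<in>nsets e m. x S)"

lemma lift_0: "lift 0 x e = x {}"
  by (simp add: lift_def nsets_def conj_commute cong: conj_cong)

lemma lift_insert:
  assumes "finite e" "a \<notin> e"
  shows "lift (Suc m) x (insert a e) = lift (Suc m) x e + lift m (\<lambda>S. x (insert a S)) e"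
proof -
  have eq: "nsets (insert a e) (Suc m) = nsets e (Suc m) \<union> insert a ` nsets e m"
  proof
    show "nsets (insert a e) (Suc m) \<subseteq> nsets e (Suc m) \<union> insert a ` nsets e m"
    proof
      fix S assume S: "S \<in> nsets (insert a e) (Suc m)"
      show "S \<in> nsets e (Suc m) \<union> insert a ` nsets e m"
      proof (cases "a \<in> S")
        case True
        then have "S = insert a (S - {a})" "S - {a} \<in> nsets e m"
          using S by (auto simp: nsets_def)
        then show ?thesis by blast
      next
        case False
        then show ?thesis using S by (auto simp: nsets_def)
      qed
    qed
    show "nsets e (Suc m) \<union> insert a ` nsets e m \<subseteq> nsets (insert a e) (Suc m)"
      using assms by (auto simp: nsets_def card_insert_if)
  qed
  have inj: "inj_on (insert a) (nsets e m)"
    using assms(2) by (intro inj_onI) (auto simp: nsets_def)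
  have "nsets e (Suc m) \<inter> insert a ` nsets e m = {}"
    using assms(2) by (auto simp: nsets_def)
  then show ?thesis
    unfolding lift_def eq using assms(1)
    by (simp add: sum.union_disjoint finite_imp_finite_nsets sum.reindex[OF inj])
qed

text \<open>Sets missing both ends of a pair cancel in the difference over it. The surviving sets
  contain an end of each pair, so only \<open>m - length ps\<close> elements remain to be chosen in
  \<open>U\<close>.\<close>

lemma swap_diff_lift:
  assumes "finite U" "U \<inter> verts ps = {}" "disjoint_pairs ps" "length ps \<le> m"
  shows "swap_diff ps (lift m x) U = lift (m - length ps) (swap_diff ps x) U"
  using assms
proof (induction ps arbitrary: U rule: verts.induct)
  case 1
  then show ?case by (simp add: lift_def)
next
  case (2 a b ps)
  define k where "k = m - Suc (length ps)"
  have k: "m - length ps = Suc k" using 2(5) unfolding k_def by simp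
  have IH: "swap_diff ps (lift m x) (insert v U) = lift (Suc k) (swap_diff ps x) (insert v U)"
    if "v \<in> {a, b}" for v
    using 2 that k by auto
  have "swap_diff ((a, b) # ps) (lift m x) U =
      lift k (\<lambda>S. swap_diff ps x (insert a S)) U - lift k (\<lambda>S. swap_diff ps x (insert b S)) U"
    using IH 2(2,3) by (simp add: lift_insert)
  also have "\<dots> = lift k (swap_diff ((a, b) # ps) x) U"
    by (simp add: lift_def sum_subtractf)
  finally show ?case by (simp only: k_def length_Cons)
qed

text \<open>After \<open>s\<close> differences the surviving sets use no vertex of \<open>U\<close>.
  The value is therefore independent of \<open>U\<close>, and one more difference gives
  zero.\<close>

lemma deg_less_lift: "deg_less V r (Suc s) (lift s x)"
  unfolding deg_less_def
proof (intro allI impI)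
  fix ps U k
  assume *: "length ps = Suc s" "disjoint_pairs ps" "U \<in> nsets (V - verts ps) k"
  then obtain a b qs where ps: "ps = (a, b) # qs" "length qs = s"
    by (metis length_Suc_conv surj_pair)
  have "swap_diff qs (lift s x) (insert v U) = swap_diff qs x {}" if "v \<in> {a, b}" for v
    using swap_diff_lift[of "insert v U" qs s x] * ps that by (auto simp: nsets_def lift_0)
  then show "swap_diff ps (lift s x) U = 0" using ps by simp
qed

text \<open>Gottlieb's theorem: the inclusion matrix of the complete \<open>r\<close>-graph has full column rank.\<close>

lemma lift_nonzero:
  assumes fin: "finite V" and n: "r + s \<le> card V" "s \<le> r" and S: "S \<in> nsets V s" "x S \<noteq> 0"
  shows "\<exists>e\<in>nsets V r. lift s x e \<noteq> 0"
proof -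
  \<comment> \<open>Vacuously true, since \<open>k + Suc s = s\<close> has no solution.\<close>
  have "deg_less V s (Suc s) x" by (simp add: deg_less_def)
  then obtain d ps where d: "d \<le> s" and ps: "length ps = d" "disjoint_pairs ps" "verts ps \<subseteq> V"
    and deg: "deg_less V s (Suc d) x"
    and nz: "\<And>U. U \<in> nsets (V - verts ps) (s - d) \<Longrightarrow> swap_diff ps x U \<noteq> 0"
    and ne: "nsets (V - verts ps) (s - d) \<noteq> {}"
    using nondegenerate_pairsE[of V s s x S] S by metis
  obtain W where W: "W \<in> nsets (V - verts ps) (s - d)" using ne by blast
  \<comment> \<open>The paired vertices and \<open>U\<close> need \<open>2 * d + (r - d)\<close>
    vertices, at most \<open>r + s\<close>.\<close>
  have "r - d \<le> card (V - verts ps)"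
    using card_verts[OF ps(2)] ps d n by (simp add: card_Diff_subset)
  then obtain U where U: "U \<subseteq> V - verts ps" "card U = r - d" "finite U"
    using fin by (metis obtain_subset_with_card_n finite_Diff)
  have "swap_diff ps (lift s x) U = lift (s - d) (swap_diff ps x) U"
    using swap_diff_lift[of U ps s x] U ps d by auto
  \<comment> \<open>The difference of \<open>x\<close> takes one nonzero value on all
    \<open>(s - d)\<close>-sets outside the pairs, so the sum cannot cancel.\<close>
  also have "\<dots> = (\<Sum>S\<in>nsets U (s - d). swap_diff ps x W)"
    unfolding lift_def
  proof (rule sum.cong[OF refl])
    fix S assume "S \<in> nsets U (s - d)"
    then have "S \<in> nsets (V - verts ps) (s - d)" using U(1) by (auto simp: nsets_def)
    then show "swap_diff ps x S = swap_diff ps x W"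
      using swap_diff_const[OF deg ps _ _ W] d by simp
  qed
  also have "\<dots> = real ((r - d) choose (s - d)) * swap_diff ps x W"
    using U by (simp add: card_nsets)
  finally have "swap_diff ps (lift s x) U \<noteq> 0" using nz[OF W] n d by simp
  then obtain c where c: "c \<in> nsets (verts ps) d" "lift s x (c \<union> U) \<noteq> 0"
    using swap_diff_nonzeroE[OF _ ps(2)] ps(1) by metis
  have "U \<in> nsets (V - verts ps) (r - d)" using U by (simp add: nsets_def)
  then have "c \<union> U \<in> nsets V r" using nsets_Un_Diff(1)[OF c(1) _ ps(3)] d n by simp
  then show ?thesis using c(2) by blast
qed

subsection \<open>The rank of the inclusion matrix\<close>

lemma (in vec_space) rank_le_card_spanning:
  assumes A: "A \<in> carrier_mat n nc" and B: "B \<subseteq> set (cols A)" "set (cols A) \<subseteq> span B"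
  shows "rank A \<le> card B"
proof -
  have Bc: "B \<subseteq> carrier_vec n" using B(1) cols_dim[of A] A by auto
  have finB: "finite B" using B(1) finite_subset by blast
  have Ac: "set (cols A) \<subseteq> carrier_vec n" using cols_dim[of A] A by auto
  have "span (set (cols A)) = span B"
    using span_subsetI[OF Bc B(2)] span_is_monotone[OF B(1)] by blast
  then have r: "rank A = vectorspace.dim class_ring (span_vs B)" unfolding rank_def by simp
  obtain U where U: "maximal U (\<lambda>T. T \<subseteq> B \<and> lin_indpt T)"
    using maximal_exists_superset[of B "\<lambda>T. T \<subseteq> B \<and> lin_indpt T" "{}"] finB
    by (auto simp: lin_dep_def)
  have "rank A = card U" using dim_span[OF _ finB U] Bc r by simp
  moreover have "U \<subseteq> B" using U unfolding maximal_def by blast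
  ultimately show ?thesis using card_mono[OF finB] by simp
qed

lemma (in vec_space) sum_smult_in_span:
  assumes "finite J" "\<And>T. T \<in> J \<Longrightarrow> c T \<in> carrier_vec n"
  shows "vec n (\<lambda>i. \<Sum>T\<in>J. a T * c T $ i) \<in> span (c ` J)"
  using assms
proof (induction J rule: finite_induct)
  case empty
  have "vec n (\<lambda>i. 0) = (0\<^sub>v n :: 'a vec)" by auto
  then show ?case using span_empty by simp
next
  case (insert T J)
  have cc: "c ` insert T J \<subseteq> carrier_vec n" using insert.prems by auto
  have "vec n (\<lambda>i. \<Sum>T\<in>J. a T * c T $ i) \<in> span (c ` insert T J)"
    using insert span_is_monotone[of "c ` J" "c ` insert T J"] by auto
  moreover have "a T \<cdot>\<^sub>v c T \<in> span (c ` insert T J)"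
    by (rule smult_in_span[OF cc span_mem]) (use cc in auto)
  moreover have "vec n (\<lambda>i. \<Sum>T\<in>insert T J. a T * c T $ i) =
      a T \<cdot>\<^sub>v c T + vec n (\<lambda>i. \<Sum>T\<in>J. a T * c T $ i)"
  proof (intro eq_vecI)
    have dim: "dim_vec (c T) = n" using insert.prems by auto
    fix i assume "i < dim_vec (a T \<cdot>\<^sub>v c T + vec n (\<lambda>i. \<Sum>T\<in>J. a T * c T $ i))"
    then show "vec n (\<lambda>i. \<Sum>T\<in>insert T J. a T * c T $ i) $ i =
        (a T \<cdot>\<^sub>v c T + vec n (\<lambda>i. \<Sum>T\<in>J. a T * c T $ i)) $ i"
      using insert.hyps dim by simp
  qed simp
  ultimately show ?case using span_add1[of "c ` insert T J"] cc by simp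
qed

text \<open>Linear independence concerns the set of columns and does not see repetitions. A repeated
  column gives a kernel vector directly, the difference of two unit vectors.\<close>

lemma (in vec_space) kernel_vector_of_low_rank:
  assumes A: "A \<in> carrier_mat n nc" and low: "rank A < nc"
  obtains v where "v \<in> carrier_vec nc" "v \<noteq> 0\<^sub>v nc" "A *\<^sub>v v = 0\<^sub>v n"
proof (cases "distinct (cols A)")
  case True
  then have "lin_dep (set (cols A))" using lin_indpt_full_rank[OF A] low by auto
  then show thesis using lin_depE[OF A _ True] that by blast
next
  case False
  then obtain i j where ij: "i < nc" "j < nc" "i \<noteq> j" "col A i = col A j"
    using A by (auto simp: distinct_conv_nth)
  let ?v = "unit_vec nc i - unit_vec nc j :: 'a vec"
  have "?v $ i \<noteq> 0\<^sub>v nc $ i" using ij by simp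
  then have "?v \<noteq> 0\<^sub>v nc" by metis
  moreover have "A *\<^sub>v ?v = 0\<^sub>v n"
  proof (intro eq_vecI)
    fix k assume "k < dim_vec (0\<^sub>v n :: 'a vec)"
    then have k: "k < n" by simp
    have "A $$ (k, i) = A $$ (k, j)" using ij A k by (metis index_col carrier_matD)
    then show "(A *\<^sub>v ?v) $ k = 0\<^sub>v n $ k"
      using A k ij by (simp add: scalar_prod_minus_distrib[of _ nc])
  qed (use A in simp)
  ultimately show thesis using that[of ?v] by simp
qed

lemma inclusion_matrix_carrier:
  "inclusion_matrix s V G \<in> carrier_mat (card G) (card (nsets V s))"
  by (simp add: inclusion_matrix_def)

lemma cols_inclusion_matrix:
  assumes "finite V"
  shows "set (cols (inclusion_matrix s V G)) =
    (\<lambda>S. vec (card G) (\<lambda>i. if S \<subseteq> from_nat_into G i then 1 else 0)) ` nsets V s"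
    (is "_ = ?colv ` ?N")
proof -
  have fin: "finite ?N" using assms by (simp add: finite_imp_finite_nsets)
  have "cols (inclusion_matrix s V G) = map (\<lambda>j. ?colv (from_nat_into ?N j)) [0..<card ?N]"
    by (auto simp: cols_def inclusion_matrix_def intro!: eq_vecI)
  then have "set (cols (inclusion_matrix s V G)) = ?colv ` (from_nat_into ?N ` {..<card ?N})"
    by (auto simp: image_image atLeast0LessThan)
  also have "from_nat_into ?N ` {..<card ?N} = ?N"
    using bij_betw_from_nat_into_finite[OF fin] by (simp add: bij_betw_def)
  finally show ?thesis .
qed

text \<open>The columns belonging to \<open>J\<close> span the column space. Rank bounds thus reduce
  to linear relations checked edge by edge, independently of the numbering.\<close>

lemma inclusion_rank_le:
  assumes finV: "finite V" and J: "J \<subseteq> nsets V s"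
    and comb: "\<And>S. S \<in> nsets V s \<Longrightarrow> \<exists>a. \<forall>e\<in>G.
      (if S \<subseteq> e then 1 else 0) = (\<Sum>T\<in>J. a T * (if T \<subseteq> e then 1 else 0 :: real))"
  shows "inclusion_rank s V G \<le> card J"
proof -
  interpret vec_space "TYPE(real)" "card G" .
  define colv where "colv = (\<lambda>S. vec (card G) (\<lambda>i. if S \<subseteq> from_nat_into G i then 1 else (0 :: real)))"
  have cols: "set (cols (inclusion_matrix s V G)) = colv ` nsets V s"
    unfolding colv_def by (rule cols_inclusion_matrix[OF finV])
  have finJ: "finite J" using J finV finite_imp_finite_nsets finite_subset by blast
  have "colv S \<in> span (colv ` J)" if S: "S \<in> nsets V s" for S
  proof -
    obtain a where a: "\<forall>e\<in>G.
      (if S \<subseteq> e then 1 else 0) = (\<Sum>T\<in>J. a T * (if T \<subseteq> e then 1 else 0 :: real))"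
      using comb[OF S] by blast
    have G: "from_nat_into G i \<in> G" if "i < card G" for i
      using that by (intro from_nat_into) auto
    have "colv S = vec (card G) (\<lambda>i. \<Sum>T\<in>J. a T * colv T $ i)"
    proof (intro eq_vecI)
      fix i assume "i < dim_vec (vec (card G) (\<lambda>i. \<Sum>T\<in>J. a T * colv T $ i))"
      then have i: "i < card G" by simp
      then show "colv S $ i = vec (card G) (\<lambda>i. \<Sum>T\<in>J. a T * colv T $ i) $ i"
        using bspec[OF a G[OF i]] by (simp add: colv_def)
    qed (simp add: colv_def)
    then show ?thesis using sum_smult_in_span[OF finJ, of colv a] by (simp add: colv_def)
  qed
  then have "rank (inclusion_matrix s V G) \<le> card (colv ` J)"
    using J by (intro rank_le_card_spanning[OF inclusion_matrix_carrier]) (auto simp: cols)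
  also have "\<dots> \<le> card J" by (rule card_image_le[OF finJ])
  finally show ?thesis by (simp add: inclusion_rank_def)
qed

lemma inclusion_rank_le_card: "inclusion_rank s V G \<le> card (nsets V s)"
  unfolding inclusion_rank_def
  by (rule vec_space.rank_le_nc[where n = "card G"]) (simp add: inclusion_matrix_def)

text \<open>A kernel vector is read as a weight \<open>x\<close> on \<open>s\<close>-sets. The rank
  condition becomes the vanishing on \<open>G\<close> of \<open>lift s x\<close>, a function of
  degree at most \<open>s\<close>.\<close>

lemma kernel_of_inclusion_rank_less:
  assumes fin: "finite V" and G: "G \<subseteq> Pow V" and low: "inclusion_rank s V G < card (nsets V s)"
  obtains x S where "S \<in> nsets V s" "x S \<noteq> 0" "\<forall>e\<in>G. lift s x e = 0"
proof -
  let ?N = "nsets V s" and ?M = "inclusion_matrix s V G"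
  have finG: "finite G" using fin G by (meson finite_Pow_iff finite_subset)
  have finN: "finite ?N" using fin by (simp add: finite_imp_finite_nsets)
  have M: "?M \<in> carrier_mat (card G) (card ?N)"
    by (rule inclusion_matrix_carrier)
  obtain v where v: "v \<in> carrier_vec (card ?N)" "v \<noteq> 0\<^sub>v (card ?N)" "?M *\<^sub>v v = 0\<^sub>v (card G)"
    using vec_space.kernel_vector_of_low_rank[OF M] low unfolding inclusion_rank_def by blast
  have bij: "bij_betw (from_nat_into ?N) {..<card ?N} ?N"
    by (rule bij_betw_from_nat_into_finite[OF finN])
  define x where "x = (\<lambda>S. v $ inv_into {..<card ?N} (from_nat_into ?N) S)"
  have x: "x (from_nat_into ?N j) = v $ j" if "j < card ?N" for j
    using bij that by (simp add: x_def bij_betw_def inv_into_f_f)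
  obtain j where j: "j < card ?N" "v $ j \<noteq> 0" using v(1,2) by (metis carrier_vecD eq_vecI index_zero_vec)
  have "from_nat_into ?N j \<in> ?N" using j bij by (auto simp: bij_betw_def)
  moreover have "x (from_nat_into ?N j) \<noteq> 0" using x j by simp
  moreover have "lift s x e = 0" if e: "e \<in> G" for e
  proof -
    obtain i where i: "i < card G" "e = from_nat_into G i"
      using bij_betw_from_nat_into_finite[OF finG] e unfolding bij_betw_def by (metis imageE lessThan_iff)
    have "lift s x e = (\<Sum>S\<in>?N. if S \<subseteq> e then x S else 0)"
      unfolding lift_def
      by (rule sum.mono_neutral_cong_left[OF finN]) (use G e in \<open>auto simp: nsets_def\<close>)
    also have "\<dots> = (\<Sum>j<card ?N. if from_nat_into ?N j \<subseteq> e then v $ j else 0)"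
      using x by (subst sum.reindex_bij_betw[OF bij, symmetric]) (auto intro: sum.cong)
    also have "\<dots> = (?M *\<^sub>v v) $ i"
      using i v(1) by (auto simp: inclusion_matrix_def scalar_prod_def atLeast0LessThan intro!: sum.cong)
    finally show ?thesis using v(3) i by simp
  qed
  ultimately show thesis using that by blast
qed

subsection \<open>Shadows and extremal numbers\<close>

lemma card_supersets:
  assumes "finite V" "A \<in> nsets V k"
  shows "card {e \<in> nsets V (k + p). A \<subseteq> e} = (card V - k) choose p"
proof -
  have A: "A \<subseteq> V" "card A = k" "finite A" using assms by (auto simp: nsets_def)
  have "bij_betw (\<lambda>U. A \<union> U) (nsets (V - A) p) {e \<in> nsets V (k + p). A \<subseteq> e}"
  proof (rule bij_betw_byWitness[where f' = "\<lambda>e. e - A"])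
    show "(\<union>) A ` nsets (V - A) p \<subseteq> {e \<in> nsets V (k + p). A \<subseteq> e}"
    proof safe
      fix U assume "U \<in> nsets (V - A) p"
      then show "A \<union> U \<in> nsets V (k + p)"
        using A by (subst (asm) nsets_def, subst nsets_def) (auto intro!: card_Un_disjoint)
    qed
    show "(\<lambda>e. e - A) ` {e \<in> nsets V (k + p). A \<subseteq> e} \<subseteq> nsets (V - A) p"
      using A by (auto simp: nsets_def card_Diff_subset)
  qed (auto simp: nsets_def)
  then have "card {e \<in> nsets V (k + p). A \<subseteq> e} = card (nsets (V - A) p)"
    by (simp only: bij_betw_same_card)
  then show ?thesis using assms A by (simp add: card_nsets card_Diff_subset)
qed

lemma card_avoiding:
  assumes "finite V" "A \<in> nsets V k"
  shows "card {e \<in> nsets V (k + p). \<not> A \<subseteq> e} + ((card V - k) choose p) = card V choose (k + p)"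
proof -
  let ?E = "nsets V (k + p)"
  let ?B = "{e \<in> ?E. A \<subseteq> e}" and ?C = "{e \<in> ?E. \<not> A \<subseteq> e}"
  have "finite ?E" using assms(1) by (rule finite_imp_finite_nsets)
  then have fin: "finite ?B" "finite ?C" by simp_all
  have "card (?C \<union> ?B) = card ?C + card ?B"
    by (rule card_Un_disjoint[OF fin(2,1)]) blast
  moreover have "?C \<union> ?B = ?E" by blast
  ultimately have "card ?C + card ?B = card ?E" by (simp only:)
  then show ?thesis
    unfolding card_supersets[OF assms] card_nsets[OF assms(1)] .
qed

text \<open>Adding the members of \<open>F\<close> one at a time, the superset \<open>S \<union> U\<close> of the next member \<open>S\<close> is new
  whenever \<open>U\<close> avoids one point of \<open>T - S\<close> for each earlier \<open>T\<close>.\<close>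

lemma card_upper_shadow_ge:
  assumes fin: "finite V" and "F \<subseteq> nsets V k"
  shows "(\<Sum>i<card F. (card V - k - i) choose p) \<le> card (upper_shadow V k p F)"
proof -
  have "finite F" using assms finite_imp_finite_nsets finite_subset by blast
  then show ?thesis using assms(2)
  proof (induction F rule: finite_induct)
    case (insert S F)
    have S: "S \<subseteq> V" "finite S" "card S = k" using insert.prems by (auto simp: nsets_def)
    have "\<exists>x. x \<in> T - S" if T: "T \<in> F" for T
    proof -
      have "finite T" "card T = k" "T \<noteq> S" using T insert by (auto simp: nsets_def)
      then show ?thesis using S card_subset_eq[of S T] by auto
    qed
    then obtain x where x: "\<And>T. T \<in> F \<Longrightarrow> x T \<in> T - S" by metis
    let ?W = "V - S - x ` F"
    let ?new = "(\<union>) S ` nsets ?W p"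
    have "card V - k - card F \<le> card ?W"
    proof -
      have "card (V - S) = card V - k" using S fin by (simp add: card_Diff_subset)
      moreover have "card (V - S) - card (x ` F) \<le> card ?W"
        using insert.hyps(1) by (intro diff_card_le_card_Diff) simp
      ultimately show ?thesis using card_image_le[OF insert.hyps(1), of x] by simp
    qed
    then have "(card V - k - card F) choose p \<le> card (nsets ?W p)"
      using fin by (simp add: card_nsets binomial_right_mono)
    also have "\<dots> = card ?new"
      by (rule card_image[symmetric]) (intro inj_onI, auto simp: nsets_def)
    finally have new: "(card V - k - card F) choose p \<le> card ?new" .
    have old: "upper_shadow V k p F \<subseteq> upper_shadow V k p (insert S F)"
      by (auto simp: upper_shadow_def)
    have "?new \<subseteq> upper_shadow V k p (insert S F)"
    proof safe
      fix U assume "U \<in> nsets ?W p"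
      moreover from this have "S \<inter> U = {}" by (auto simp: nsets_def)
      ultimately show "S \<union> U \<in> upper_shadow V k p (insert S F)"
        using S by (auto simp: upper_shadow_def nsets_def card_Un_disjoint)
    qed
    moreover have "upper_shadow V k p F \<inter> ?new = {}"
      using x by (fastforce simp: upper_shadow_def nsets_def)
    moreover have "finite (upper_shadow V k p (insert S F))"
      using fin by (simp add: upper_shadow_def finite_imp_finite_nsets)
    ultimately have "card (upper_shadow V k p F) + card ?new \<le> card (upper_shadow V k p (insert S F))"
      using old by (metis Un_least card_Un_disjoint card_mono finite_subset)
    then show ?case using insert new by simp
  qed simp
qed

text \<open>A truncated hockey-stick identity: by Pascal's rule each summand is the drop of the
  second term as \<open>t\<close> increases.\<close>

lemma sum_choose_lower_part:
  assumes "t \<le> Suc m"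
  shows "(\<Sum>i<t. (m - i) choose p) + ((Suc m - t) choose Suc p) = Suc m choose Suc p"
  using assms
proof (induction t)
  case (Suc t)
  then have "Suc m - t = Suc (m - t)" by simp
  then show ?case using Suc by simp
qed simp

text \<open>The bound on \<open>t\<close> supplies a family of \<open>t\<close> sets; otherwise
  \<open>Min\<close> would range over the empty set.\<close>

lemma
  assumes "t \<le> n choose k"
  shows min_upper_shadow_attained: "\<exists>F\<subseteq>nsets {1..n} k. card F = t \<and>
      min_upper_shadow n t k p = card (upper_shadow {1..n} k p F)" (is ?A)
    and min_upper_shadow_le: "\<And>F. F \<subseteq> nsets {1..n} k \<Longrightarrow> card F = t \<Longrightarrow>
      min_upper_shadow n t k p \<le> card (upper_shadow {1..n} k p F)"
proof -
  let ?X = "{card (upper_shadow {1..n} k p F) | F. F \<subseteq> nsets {1..n} k \<and> card F = t}"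
  have fin: "finite (nsets {1..n} k)" by (simp add: finite_imp_finite_nsets)
  then have finX: "finite ?X" by simp
  obtain F where "F \<subseteq> nsets {1..n} k" "card F = t"
    using obtain_subset_with_card_n[of t "nsets {1..n} k"] assms
    by (metis card_atLeastAtMost card_nsets diff_Suc_1 finite_atLeastAtMost)
  then have "?X \<noteq> {}" by blast
  then have "Min ?X \<in> ?X" by (rule Min_in[OF finX])
  then show ?A unfolding min_upper_shadow_def by blast
  show "min_upper_shadow n t k p \<le> card (upper_shadow {1..n} k p F)"
    if "F \<subseteq> nsets {1..n} k" "card F = t" for F
    unfolding min_upper_shadow_def using that by (intro Min_le[OF finX]) blast
qed

text \<open>For \<open>k \<ge> 1\<close> these are the numbers of a star, \<open>t\<close> sets
  through a common \<open>(k - 1)\<close>-set: \<open>Suc (n - k) choose Suc p\<close> edges contain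
  that set, and the last term counts those outside the shadow.\<close>

lemma min_upper_shadow_ge:
  assumes "t \<le> n choose k" "k + t \<le> Suc n"
  shows "(Suc (n - k) choose Suc p) \<le> min_upper_shadow n t k p + ((Suc (n - k) - t) choose Suc p)"
proof -
  obtain F where F: "F \<subseteq> nsets {1..n} k" "card F = t"
    "min_upper_shadow n t k p = card (upper_shadow {1..n} k p F)"
    using min_upper_shadow_attained[OF assms(1), of p] by blast
  have t: "t \<le> Suc (n - k)" using assms(2) by linarith
  show ?thesis
    using F(2,3) card_upper_shadow_ge[OF _ F(1), of p] sum_choose_lower_part[OF t, of p]
    by (simp del: binomial_Suc_Suc)
qed

text \<open>The condition in \<open>t_max\<close> ranges over all \<open>t' \<le> t\<close> and so
  includes zero.\<close>

lemma min_upper_shadow_0: "min_upper_shadow n 0 k p = 0"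
  using min_upper_shadow_le[of 0 n k "{}" p] by (simp add: upper_shadow_def)

lemma min_upper_shadow_1:
  assumes "k \<le> n"
  shows "min_upper_shadow n 1 k p = (n - k) choose p"
proof (rule antisym)
  have pos: "1 \<le> n choose k" using assms by (simp add: Suc_leI)
  obtain F where F: "F \<subseteq> nsets {1..n} k" "card F = 1"
    "min_upper_shadow n 1 k p = card (upper_shadow {1..n} k p F)"
    using min_upper_shadow_attained[OF pos, of p] by blast
  then show "(n - k) choose p \<le> min_upper_shadow n 1 k p"
    using card_upper_shadow_ge[OF _ F(1), of p] by simp
  have S: "{1..k} \<in> nsets {1..n} k" using assms by (simp add: nsets_def)
  have "min_upper_shadow n 1 k p \<le> card (upper_shadow {1..n} k p {{1..k}})"
    by (rule min_upper_shadow_le[OF pos]) (use S in auto)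
  also have "\<dots> = (n - k) choose p"
    using card_supersets[OF _ S, of p] by (simp add: upper_shadow_def)
  finally show "min_upper_shadow n 1 k p \<le> (n - k) choose p" .
qed

section \<open>Extremal numbers for \<open>t = 0\<close> and \<open>t = 1\<close>\<close>

lemma
  shows rex_attained: "\<exists>G\<subseteq>nsets {1..n} r. inclusion_rank s {1..n} G \<le> (n choose s) - t \<and>
      rex n t r s = card G" (is ?A)
    and rex_ge: "\<And>G. G \<subseteq> nsets {1..n} r \<Longrightarrow> inclusion_rank s {1..n} G \<le> (n choose s) - t \<Longrightarrow>
      card G \<le> rex n t r s"
proof -
  let ?X = "{card G | G. G \<subseteq> nsets {1..n} r \<and> inclusion_rank s {1..n} G \<le> (n choose s) - t}"
  have "finite (nsets {1..n} r)" by (simp add: finite_imp_finite_nsets)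
  then have finX: "finite ?X" by simp
  \<comment> \<open>The empty graph has rank zero and is admissible for every
    \<open>t\<close>.\<close>
  have "inclusion_rank s {1..n} {} \<le> card ({} :: nat set set)"
    by (rule inclusion_rank_le) auto
  then have "?X \<noteq> {}" by auto
  then have "Max ?X \<in> ?X" by (rule Max_in[OF finX])
  then show ?A unfolding rex_def by blast
  show "card G \<le> rex n t r s"
    if "G \<subseteq> nsets {1..n} r" "inclusion_rank s {1..n} G \<le> (n choose s) - t" for G
    unfolding rex_def using that by (intro Max_ge[OF finX]) blast
qed

lemma rex_0: "rex n 0 r s = n choose r"
proof (rule antisym)
  obtain G where G: "G \<subseteq> nsets {1..n} r" "rex n 0 r s = card G"
    using rex_attained[of n r s 0] by blast
  then have "card G \<le> card (nsets {1..n} r)"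
    by (intro card_mono) (simp_all add: finite_imp_finite_nsets)
  then show "rex n 0 r s \<le> n choose r" using G by (simp add: card_nsets)
  have "card (nsets {1..n} r) \<le> rex n 0 r s"
    using inclusion_rank_le_card[of s "{1..n}" "nsets {1..n} r"]
    by (intro rex_ge) (simp_all add: card_nsets)
  then show "n choose r \<le> rex n 0 r s" by (simp add: card_nsets)
qed

lemma sum_pick:
  fixes y :: "'a \<Rightarrow> real"
  assumes "finite J" "S \<in> J"
  shows "(\<Sum>T\<in>J. (if T = S then 1 else 0) * y T) = y S"
proof -
  have "(\<Sum>T\<in>J. (if T = S then 1 else 0) * y T) = (\<Sum>T\<in>J. if T = S then y T else 0)"
    by (rule sum.cong) auto
  then show ?thesis using assms by (simp add: sum.delta)
qed

text \<open>The column of \<open>S\<close> is zero, so the remaining columns span.\<close>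

lemma rank_avoiding_one_set:
  assumes fin: "finite V" and S: "S \<in> nsets V s" and G: "\<And>e. e \<in> G \<Longrightarrow> \<not> S \<subseteq> e"
  shows "inclusion_rank s V G \<le> (card V choose s) - 1"
proof -
  have finN: "finite (nsets V s)" using fin by (simp add: finite_imp_finite_nsets)
  have "inclusion_rank s V G \<le> card (nsets V s - {S})"
  proof (rule inclusion_rank_le[OF fin])
    fix T assume T: "T \<in> nsets V s"
    show "\<exists>a. \<forall>e\<in>G. (if T \<subseteq> e then 1 else 0) =
        (\<Sum>T\<in>nsets V s - {S}. a T * (if T \<subseteq> e then 1 else 0 :: real))"
    proof (cases "T = S")
      case True
      then show ?thesis using G by (intro exI[of _ "\<lambda>_. 0"]) simp
    next
      case False
      then have "T \<in> nsets V s - {S}" using T by blast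
      from sum_pick[OF finite_Diff[OF finN] this] show ?thesis
        by (intro exI[of _ "\<lambda>T'. if T' = T then 1 else 0"]) simp
    qed
  qed auto
  then show ?thesis using S fin finN by (simp add: card_nsets)
qed

text \<open>A graph of deficient rank misses the support of a nonzero column combination of the
  complete graph, and \<open>support_ge\<close> bounds that support from below. Conversely, removing
  all edges through one \<open>s\<close>-set lowers the rank.\<close>

lemma rex_1:
  assumes "s \<le> r"
  shows "\<exists>n0. \<forall>n\<ge>n0. rex n 1 r s + ((n - s) choose (r - s)) = n choose r"
proof -
  obtain n1 where n1: "\<And>V (f :: nat set \<Rightarrow> real). finite V \<Longrightarrow> n1 \<le> card V \<Longrightarrow>
    deg_less V r (Suc s) f \<Longrightarrow> \<exists>e\<in>nsets V r. f e \<noteq> 0 \<Longrightarrow>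
    (card V - s) choose (r - s) \<le> card {e \<in> nsets V r. f e \<noteq> 0}"
    using support_ge[OF assms] by blast
  show ?thesis
  proof (intro exI[of _ "n1 + r + s"] allI impI antisym)
    fix n assume n: "n1 + r + s \<le> n"
    let ?V = "{1..n}"
    let ?E = "nsets ?V r"
    have finE: "finite ?E" by (simp add: finite_imp_finite_nsets)
    obtain G where G: "G \<subseteq> ?E" "inclusion_rank s ?V G \<le> (n choose s) - 1" "rex n 1 r s = card G"
      using rex_attained[of n r s 1] by blast
    have "0 < n choose s" using n by simp
    then have low: "inclusion_rank s ?V G < card (nsets ?V s)" using G(2) by (simp add: card_nsets del: zero_less_binomial_iff)
    have GV: "G \<subseteq> Pow ?V" using G(1) by (auto simp: nsets_def)
    obtain x S where x: "S \<in> nsets ?V s" "x S \<noteq> 0" "\<forall>e\<in>G. lift s x e = 0"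
      by (rule kernel_of_inclusion_rank_less[OF finite_atLeastAtMost GV low])
    have "\<exists>e\<in>?E. lift s x e \<noteq> 0"
      by (rule lift_nonzero[of _ r s S x]) (use x n assms in auto)
    then have "(n - s) choose (r - s) \<le> card {e \<in> ?E. lift s x e \<noteq> 0}"
      using n1[of ?V "lift s x", OF _ _ deg_less_lift] n by simp
    moreover have "card G + card {e \<in> ?E. lift s x e \<noteq> 0} \<le> card ?E"
    proof -
      have "G \<inter> {e \<in> ?E. lift s x e \<noteq> 0} = {}" using x(3) by auto
      then have "card G + card {e \<in> ?E. lift s x e \<noteq> 0} = card (G \<union> {e \<in> ?E. lift s x e \<noteq> 0})"
        using finE G(1) finite_subset by (subst card_Un_disjoint) auto
      also have "\<dots> \<le> card ?E" using G(1) by (intro card_mono[OF finE]) auto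
      finally show ?thesis .
    qed
    ultimately show "rex n 1 r s + ((n - s) choose (r - s)) \<le> n choose r"
      using G(3) by (simp add: card_nsets)
    have S: "{1..s} \<in> nsets ?V s" using n by (simp add: nsets_def)
    let ?H = "{e \<in> ?E. \<not> {1..s} \<subseteq> e}"
    have "inclusion_rank s ?V ?H \<le> (n choose s) - 1"
      using rank_avoiding_one_set[of ?V "{1..s}" s ?H] S by simp
    then have "card ?H \<le> rex n 1 r s" by (intro rex_ge) auto
    moreover have "card ?H + ((n - s) choose (r - s)) = n choose r"
      using card_avoiding[OF _ S, of "r - s"] assms by simp
    ultimately show "n choose r \<le> rex n 1 r s + ((n - s) choose (r - s))" by simp
  qed
qed

section \<open>A dense graph of low rank for \<open>t = n - r - 1\<close>\<close>

text \<open>\<open>I \<subseteq> {..<m}\<close> selects one end of each pair \<open>{s + 2i, s + 2i + 1}\<close>, \<open>i < m\<close>.\<close>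

definition transversal :: "nat \<Rightarrow> nat \<Rightarrow> nat set \<Rightarrow> nat set" where
  "transversal s m I = (\<lambda>i. s + 2 * i + of_bool (i \<in> I)) ` {..<m}"

lemma in_transversal_iff:
  assumes "j < m"
  shows "s + 2 * j \<in> transversal s m I \<longleftrightarrow> j \<notin> I"
    and "Suc (s + 2 * j) \<in> transversal s m I \<longleftrightarrow> j \<in> I"
proof -
  have 1: "s + 2 * j = s + 2 * i + of_bool (i \<in> I) \<longleftrightarrow> i = j \<and> i \<notin> I" for i
    by (cases "i \<in> I"; simp; presburger)
  have 2: "Suc (s + 2 * j) = s + 2 * i + of_bool (i \<in> I) \<longleftrightarrow> i = j \<and> i \<in> I" for i
    by (cases "i \<in> I"; simp; presburger)
  show "s + 2 * j \<in> transversal s m I \<longleftrightarrow> j \<notin> I"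
    unfolding transversal_def image_iff Bex_def 1 using assms by auto
  show "Suc (s + 2 * j) \<in> transversal s m I \<longleftrightarrow> j \<in> I"
    unfolding transversal_def image_iff Bex_def 2 using assms by auto
qed

lemma card_transversal: "card (transversal s m I) = m"
proof -
  have "inj_on (\<lambda>i. s + 2 * i + of_bool (i \<in> I)) {..<m}"
  proof (rule inj_onI)
    fix i j assume "s + 2 * i + of_bool (i \<in> I) = s + 2 * j + of_bool (j \<in> I)"
    then show "i = j" by (cases "i \<in> I"; cases "j \<in> I"; simp; presburger)
  qed
  then show ?thesis by (simp add: transversal_def card_image)
qed

lemma transversal_subset: "transversal s m I \<subseteq> {s..<s + 2 * m}"
  by (auto simp: transversal_def of_bool_def)

lemma inj_on_transversal: "inj_on (transversal s m) (Pow {..<m})"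
proof (rule inj_onI)
  fix I J assume *: "I \<in> Pow {..<m}" "J \<in> Pow {..<m}" "transversal s m I = transversal s m J"
  have "i \<in> I \<longleftrightarrow> i \<in> J" if "i < m" for i
    using in_transversal_iff(2)[OF that, of s I] in_transversal_iff(2)[OF that, of s J] *(3) by simp
  then show "I = J" using *(1,2) by blast
qed

text \<open>Replacing the edges through an \<open>(s - 1)\<close>-set \<open>A\<close> by the \<open>2 ^ m\<close> edges \<open>A \<union> e\<close> with \<open>e\<close> a
  transversal of \<open>m = r - s + 1\<close> pairs of vertices kills the columns \<open>A \<union> {x}\<close> for \<open>x\<close> outside the
  pairs, while the two columns of each pair have the same sum.\<close>

lemma rex_ge_transversals:
  fixes n r s :: nat
  assumes s: "1 \<le> s" "s < r"
  defines "m \<equiv> r - s + 1"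
  assumes n: "s + 2 * m \<le> n"
  shows "n - r - 1 \<le> n choose s"
    and "(n choose r) + 2 ^ m \<le> rex n (n - r - 1) r s + (Suc (n - s) choose m)"
proof -
  let ?V = "{1..n}"
  let ?N = "nsets ?V s"
  define A where "A = {1..<s}"
  have A: "A \<subseteq> ?V" "finite A" "card A = s - 1" "\<And>x. x \<in> A \<Longrightarrow> x < s"
    using s n by (auto simp: A_def)
  have AN: "A \<in> nsets ?V (s - 1)" using A by (simp add: nsets_def)
  define H where "H = (\<lambda>I. A \<union> transversal s m I) ` Pow {..<m}"
  define G where "G = {e \<in> nsets ?V r. \<not> A \<subseteq> e} \<union> H"
  have At: "A \<inter> transversal s m I = {}" for I
    using transversal_subset[of s m I] A(4) by fastforce
  have tV: "transversal s m I \<subseteq> ?V" for I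
    using transversal_subset[of s m I] s n by fastforce
  have ft: "finite (transversal s m I)" for I by (simp add: transversal_def)
  have HV: "H \<subseteq> nsets ?V r"
  proof
    fix e assume "e \<in> H"
    then obtain I where e: "e = A \<union> transversal s m I" unfolding H_def by blast
    have "card e = r"
      unfolding e using A(2,3) At ft s by (simp add: card_Un_disjoint card_transversal m_def)
    then show "e \<in> nsets ?V r" using e A tV ft by (simp add: nsets_def)
  qed
  have GV: "G \<subseteq> nsets ?V r" using HV unfolding G_def by blast
  have fin: "finite (nsets ?V k)" for k by (simp add: finite_imp_finite_nsets)

  have cH: "card H = 2 ^ m"
  proof -
    have "inj_on (\<lambda>I. A \<union> transversal s m I) (Pow {..<m})"
    proof (rule inj_onI)
      fix I J assume *: "I \<in> Pow {..<m}" "J \<in> Pow {..<m}"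
        "A \<union> transversal s m I = A \<union> transversal s m J"
      then have "transversal s m I = transversal s m J" using At by blast
      then show "I = J" using inj_on_transversal *(1,2) by (meson inj_onD)
    qed
    then show ?thesis by (simp add: H_def card_image card_Pow)
  qed
  have cG: "card G + (Suc (n - s) choose m) = (n choose r) + 2 ^ m"
  proof -
    let ?C = "{e \<in> nsets ?V r. \<not> A \<subseteq> e}"
    have "card ?C + ((card ?V - (s - 1)) choose m) = card ?V choose r"
      using card_avoiding[OF _ AN, of m] s by (simp add: m_def)
    moreover have "card ?V - (s - 1) = Suc (n - s)" using s n by simp
    moreover have "card G = card ?C + card H"
      unfolding G_def by (rule card_Un_disjoint) (use fin HV finite_subset in \<open>auto simp: H_def\<close>)
    ultimately show ?thesis using cH by simp
  qed

  \<comment> \<open>The columns dropped: one for each vertex beyond the pairs, and one for each pair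
    except pair 0, which serves as reference. Their number is
    \<open>(n - s - 2 * m + 1) + (m - 1) = n - r - 1\<close>.\<close>
  define X where "X = {s + 2 * m..n} \<union> (\<lambda>i. Suc (s + 2 * i)) ` {1..<m}"
  define R where "R = (\<lambda>x. insert x A) ` X"
  have insA: "insert x A = insert y A \<longleftrightarrow> x = y" if "s \<le> x" "s \<le> y" for x y
    using that A(4) by (metis insert_iff leD)
  have X_ge: "s \<le> x" if "x \<in> X" for x using that by (auto simp: X_def)
  have insN: "insert x A \<in> ?N" if "s \<le> x" "x \<le> n" for x
  proof -
    have "x \<notin> A" using that A(4) by fastforce
    then show ?thesis using that A s by (auto simp: nsets_def)
  qed
  have RN: "R \<subseteq> ?N"
    using insN X_ge n s by (fastforce simp: R_def X_def)
  have cR: "card R = n - r - 1"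
  proof -
    have "card R = card X"
      unfolding R_def using insA X_ge by (intro card_image inj_onI) blast
    also have "\<dots> = card {s + 2 * m..n} + card ((\<lambda>i. Suc (s + 2 * i)) ` {1..<m})"
      unfolding X_def by (rule card_Un_disjoint) auto
    also have "card ((\<lambda>i. Suc (s + 2 * i)) ` {1..<m}) = m - 1"
      by (subst card_image) (auto intro: inj_onI)
    finally show ?thesis using s n by (simp add: m_def)
  qed
  then show "n - r - 1 \<le> n choose s"
    using card_mono[OF fin RN] by (simp add: card_nsets)

  have "inclusion_rank s ?V G \<le> card (?N - R)"
  proof (rule inclusion_rank_le)
    fix S assume S: "S \<in> ?N"
    let ?ind = "\<lambda>S e. if S \<subseteq> e then 1 else 0 :: real"
    let ?pick = "\<lambda>S T. if T = S then 1 else 0 :: real"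
    have pick: "(\<Sum>T\<in>?N - R. ?pick S T * ?ind T e) = ?ind S e" if "S \<in> ?N - R" for S e
      by (rule sum_pick) (use that fin in auto)
    consider (free) "S \<in> ?N - R" | (out) x where "S = insert x A" "s + 2 * m \<le> x"
      | (pair) i where "S = insert (Suc (s + 2 * i)) A" "1 \<le> i" "i < m"
    proof (cases "S \<in> R")
      case True
      then obtain x where x: "S = insert x A" "x \<in> X" unfolding R_def by blast
      from x(2) consider "s + 2 * m \<le> x" | i where "x = Suc (s + 2 * i)" "1 \<le> i" "i < m"
        unfolding X_def by auto
      then show ?thesis using x(1) out pair by metis
    qed (use S free in blast)
    then show "\<exists>a. \<forall>e\<in>G. ?ind S e = (\<Sum>T\<in>?N - R. a T * ?ind T e)"
    proof cases
      case free
      then show ?thesis using pick by (intro exI[of _ "?pick S"]) simp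
    next
      case (out x)
      have "\<not> S \<subseteq> e" if e: "e \<in> G" for e
      proof (cases "e \<in> H")
        case True
        then obtain I where "e = A \<union> transversal s m I" unfolding H_def by blast
        then have "x \<notin> e" using out(2) A(4) transversal_subset[of s m I] by fastforce
        then show ?thesis using out(1) by blast
      next
        case False
        then show ?thesis using e out(1) unfolding G_def by blast
      qed
      then show ?thesis by (intro exI[of _ "\<lambda>_. 0"]) simp
    next
      case (pair i)
      have notX: "s + 2 * j \<notin> X" if "j < m" for j
        using that by (auto simp: X_def) presburger
      have notX': "Suc s \<notin> X" using pair by (auto simp: X_def)
      have free: "insert x A \<in> ?N - R" if "s \<le> x" "x \<le> n" "x \<notin> X" for x
        using insN[OF that(1,2)] insA[OF that(1)] X_ge that(3) unfolding R_def by auto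
      let ?T1 = "insert s A" and ?T2 = "insert (Suc s) A" and ?T3 = "insert (s + 2 * i) A"
      have T: "?T1 \<in> ?N - R" "?T2 \<in> ?N - R" "?T3 \<in> ?N - R"
        using free[of s] free[of "Suc s"] free[of "s + 2 * i"] notX[of 0] notX[of i] notX' pair n
        by auto
      \<comment> \<open>The dropped column is the sum of the two columns of pair 0 minus the
        retained column of pair \<open>i\<close>.\<close>
      let ?a = "\<lambda>T. ?pick ?T1 T + ?pick ?T2 T - ?pick ?T3 T"
      have "\<forall>e\<in>G. ?ind S e = (\<Sum>T\<in>?N - R. ?a T * ?ind T e)"
      proof
        fix e assume e: "e \<in> G"
        have "(\<Sum>T\<in>?N - R. ?a T * ?ind T e) = (\<Sum>T\<in>?N - R. ?pick ?T1 T * ?ind T e)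
            + (\<Sum>T\<in>?N - R. ?pick ?T2 T * ?ind T e) - (\<Sum>T\<in>?N - R. ?pick ?T3 T * ?ind T e)"
          unfolding sum.distrib[symmetric] sum_subtractf[symmetric]
          by (rule sum.cong) (auto simp: algebra_simps)
        also have "\<dots> = ?ind ?T1 e + ?ind ?T2 e - ?ind ?T3 e"
          by (simp only: pick[OF T(1)] pick[OF T(2)] pick[OF T(3)])
        also have "\<dots> = ?ind S e"
        \<comment> \<open>The edges of \<open>G\<close> through \<open>A\<close> are transversal and
          contain exactly one end of each pair. On all other edges the four entries vanish.\<close>
        proof (cases "A \<subseteq> e")
          case True
          then obtain I where I: "e = A \<union> transversal s m I" using e unfolding G_def H_def by blast
          have *: "x \<in> e \<longleftrightarrow> x \<in> transversal s m I" if "s \<le> x" for x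
            using I A(4) that by (auto dest: leD)
          have "s \<in> e \<longleftrightarrow> 0 \<notin> I" "Suc s \<in> e \<longleftrightarrow> 0 \<in> I"
            using in_transversal_iff[of 0 m s I] pair * by auto
          moreover have "s + 2 * i \<in> e \<longleftrightarrow> i \<notin> I" "Suc (s + 2 * i) \<in> e \<longleftrightarrow> i \<in> I"
            using in_transversal_iff[OF pair(3), of s I] * by auto
          ultimately show ?thesis using True pair(1) by auto
        qed (use pair(1) in auto)
        finally show "?ind S e = (\<Sum>T\<in>?N - R. ?a T * ?ind T e)" by (rule sym)
      qed
      then show ?thesis by (rule exI[of _ ?a])
    qed
  qed auto
  also have "\<dots> = (n choose s) - (n - r - 1)"
    using RN fin cR by (simp add: card_Diff_subset finite_subset card_nsets)
  finally show "(n choose r) + 2 ^ m \<le> rex n (n - r - 1) r s + (Suc (n - s) choose m)"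
    using rex_ge[OF GV] cG by fastforce
qed

section \<open>The bound on \<open>t_max\<close>\<close>

lemma Suc_less_two_power: "2 \<le> m \<Longrightarrow> Suc m < 2 ^ m" for m :: nat
  by (induction m rule: dec_induct) auto

theorem theorem7:
  fixes r s :: nat
  assumes "1 \<le> s" and "s < r"
  shows "\<exists>n0 :: nat. \<forall>n\<ge>n0. int (t_max n r s) < int n - int r - 1"
proof -
  obtain n1 where n1: "\<And>n. n1 \<le> n \<Longrightarrow> rex n 1 r s + ((n - s) choose (r - s)) = n choose r"
    using rex_1[of s r] assms by auto
  define m where "m = r - s + 1"
  show ?thesis
  \<comment> \<open>The summand \<open>n1\<close> serves \<open>t = 1\<close>; the others make room
    for the pairs and keep the subtraction \<open>n - r - 1\<close> from truncating.\<close>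
  proof (intro exI[of _ "n1 + r + s + 2 * m + 2"] allI impI)
    fix n assume n: "n1 + r + s + 2 * m + 2 \<le> n"
    define ok where "ok t \<longleftrightarrow> int (n choose r) - int (rex n t r s) = int (min_upper_shadow n t s (r - s))" for t
    define T where "T = {t. 1 \<le> t \<and> t \<le> n choose s \<and> (\<forall>t'\<le>t. ok t')}"
    have finT: "finite T" by (rule finite_subset[of _ "{..n choose s}"]) (auto simp: T_def)
    have "ok 0" by (simp add: ok_def rex_0 min_upper_shadow_0)
    moreover have "ok 1" using n1[of n] n min_upper_shadow_1[of s n "r - s"] by (simp add: ok_def)
    moreover have "1 \<le> n choose s" using n by (simp add: Suc_leI)
    ultimately have "1 \<in> T" by (auto simp: T_def le_Suc_eq)
    then have max: "t_max n r s \<in> T"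
      using Max_in[OF finT] unfolding t_max_def T_def ok_def by blast
    have not_ok: "\<not> ok (n - r - 1)"
    proof
      let ?t = "n - r - 1"
      assume "ok ?t"
      then have eq: "int (n choose r) = int (rex n ?t r s) + int (min_upper_shadow n ?t s (r - s))"
        by (simp add: ok_def)
      have t: "?t \<le> n choose s"
        and low: "(n choose r) + 2 ^ m \<le> rex n ?t r s + (Suc (n - s) choose m)"
        using rex_ge_transversals[OF assms, folded m_def] n by auto
      have "(Suc (n - s) choose m) \<le> min_upper_shadow n ?t s (r - s) + ((Suc (n - s) - ?t) choose m)"
        using min_upper_shadow_ge[OF t, of "r - s"] n assms by (simp add: m_def)
      \<comment> \<open>Here \<open>n - s + 1 - (n - r - 1) = r - s + 2 = m + 1\<close>.\<close>
      moreover have "(Suc (n - s) - ?t) choose m = Suc m"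
      proof -
        have "Suc (n - s) - ?t = Suc m" using n assms by (simp add: m_def)
        then show ?thesis by (simp only: binomial_Suc_n)
      qed
      \<comment> \<open>The extremal number, the minimal shadow and the count of edges through
        \<open>A\<close> cancel, leaving an inequality that fails for \<open>m \<ge> 2\<close>, that
        is, for \<open>s < r\<close>.\<close>
      ultimately have "2 ^ m \<le> Suc m" using low eq by linarith
      moreover have "2 \<le> m" using assms by (simp add: m_def)
      ultimately show False using Suc_less_two_power[of m] by simp
    qed
    have "\<forall>t'\<le>t_max n r s. ok t'" using max unfolding T_def by simp
    then have "\<not> n - r - 1 \<le> t_max n r s" using not_ok by blast
    then show "int (t_max n r s) < int n - int r - 1" by linarith
  qed
qed

end
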